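(* For every integer $T\ge0$, every real sequence $u$, and every $\sigma_\varnothing^{T+1}\in\{-1,+1\}^{T+2}$, the root trajectory distribution of the dynamics under external field satisfies $$\mathbb P(\sigma_\varnothing^{T+1}\|u^{T+1})=\mathbb P_0(\sigma_\varnothing(0))\sum_{\sigma_1^T,\dots,\sigma_{k-1}^T}\ \prod_{t=0}^{T}\mathsf K_{u(t)}\big(\sigma_\varnothing(t+1)|\sigma_{\partial\varnothing}(t)\big)\ \prod_{i=1}^{k-1}\mathbb P(\sigma_i^T\|\sigma_\varnothing^T),$$ where the sum is over $\sigma_1^T,\dots,\sigma_{k-1}^T\in\{-1,+1\}^{T+1}$ and $$\mathsf K_{u(t)}\big(\sigma_\varnothing(t+1)|\sigma_{\partial\varnothing}(t)\big)=\begin{cases}\mathbb I\big\{\sigma_\varnothing(t+1)=\mathrm{sign}\big(\sum_{i=1}^{k-1}\sigma_i(t)+u(t)\big)\big\}&\text{if }\sum_{i=1}^{k-1}\sigma_i(t)+u(t)\neq0,\\ \tfrac12&\text{otherwise.}\end{cases}$$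
   Context: Dynamics under external field. Let $k\ge2$ and let $\mathcal G_\varnothing$ be the infinite tree rooted at a vertex $\varnothing$ in which the root has degree $k-1$ (its neighbors are denoted $1,\dots,k-1$) and every other vertex has degree $k$. Let $u=(u(0),u(1),\dots)$ be an arbitrary sequence of real numbers. Spins $\sigma_i(t)\in\{-1,+1\}$, $t=0,1,2,\dots$, are updated synchronously. For $i\ne\varnothing$: $\sigma_i(t+1)=\mathrm{sign}(\sum_{j\in\partial i}\sigma_j(t))$ if the sum over the neighbors $\partial i$ of $i$ is nonzero, and otherwise $\sigma_i(t+1)=\pm\sigma_i(t)$ with probability $1/2$ each. For the root: $\sigma_\varnothing(t+1)=\mathrm{sign}\big(\sum_{i=1}^{k-1}\sigma_i(t)+u(t)\big)$, and $\sigma_\varnothing(t+1)$ is uniform on $\{\pm1\}$ if the argument is $0$. All tie-breaking coins are independent across vertices and times and independent of the initial spins. Initial spins are i.i.d. $\{-1,+1\}$-valued with common distribution $\mathbb P_0$. Write $a^T=(a(0),\dots,a(T))$. $\mathbb P(\sigma_\varnothing^T\|u^T)$ denotes the probability that the root spin follows the trajectory $\sigma_\varnothing^T$ up to time $T$ under this dynamics with external field $u$ (it is not a conditional probability; it does not depend on $u(t)$ for $t\geq T$). In the recursion $\mathbb P(\sigma_i^T\|\sigma_\varnothing^T)$ is this same function evaluated at trajectory $\sigma_i^T$ and external field $\sigma_\varnothing^T$. *)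

theory Defs
  imports "HOL-Probability.Probability"
begin

text \<open>The infinite tree: a vertex is the list of child labels along the path from the root
  \<open>[]\<close>, so every vertex has the \<open>k - 1\<close> children \<open>v @ [1], \<dots>, v @ [k - 1]\<close>, and every vertex
  other than the root has one further neighbour, its parent.\<close>

definition tree_verts :: "nat \<Rightarrow> nat list set" where
  "tree_verts k = lists {1..k - 1}"

definition nbrs :: "nat \<Rightarrow> nat list \<Rightarrow> nat list set" where
  "nbrs k v = {w \<in> tree_verts k. (\<exists>i. w = v @ [i]) \<or> (\<exists>i. v = w @ [i])}"

text \<open>Spins are integers \<open>-1\<close>, \<open>1\<close>. The arguments of \<open>spin\<close> are the external field \<open>u\<close>,
  the initial configuration \<open>x\<close> and the tie-breaking coins \<open>c\<close>, where \<open>c (v, t)\<close> is used at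
  vertex \<open>v\<close> in the update from time \<open>t\<close> to \<open>t + 1\<close>. At the root a tie gives the coin itself,
  elsewhere the coin times the current spin. The floor only converts the real number
  \<open>sgn h\<close>, which is \<open>1\<close> or \<open>-1\<close> there, to an integer.\<close>

primrec spin ::
  "nat \<Rightarrow> (nat \<Rightarrow> real) \<Rightarrow> (nat list \<Rightarrow> int) \<Rightarrow> (nat list \<times> nat \<Rightarrow> int) \<Rightarrow> nat \<Rightarrow> nat list \<Rightarrow> int"
where
  "spin k u x c 0 v = x v"
| "spin k u x c (Suc t) v =
     (if v = [] then
        let h = real_of_int (\<Sum>w\<in>nbrs k []. spin k u x c t w) + u t
        in if h \<noteq> 0 then \<lfloor>sgn h\<rfloor> else c ([], t)
      else
        let h = (\<Sum>w\<in>nbrs k v. spin k u x c t w)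
        in if h \<noteq> 0 then sgn h else c (v, t) * spin k u x c t v)"

definition dyn_space ::
  "nat \<Rightarrow> int pmf \<Rightarrow> ((nat list \<Rightarrow> int) \<times> (nat list \<times> nat \<Rightarrow> int)) measure"
where
  "dyn_space k P0 =
     (\<Pi>\<^sub>M v\<in>tree_verts k. measure_pmf P0)
       \<Otimes>\<^sub>M (\<Pi>\<^sub>M vt\<in>tree_verts k \<times> UNIV. measure_pmf (pmf_of_set {-1, 1}))"

text \<open>\<open>traj_prob k P0 T s u\<close> is the probability of the root trajectory \<open>s 0, \<dots>, s T\<close> under the
  external field \<open>u\<close>. The functions \<open>s\<close> and \<open>u\<close> stand for finite sequences: only the values
  \<open>s t\<close> for \<open>t \<le> T\<close> and \<open>u t\<close> for \<open>t < T\<close> matter.\<close>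

definition traj_prob :: "nat \<Rightarrow> int pmf \<Rightarrow> nat \<Rightarrow> (nat \<Rightarrow> int) \<Rightarrow> (nat \<Rightarrow> real) \<Rightarrow> real" where
  "traj_prob k P0 T s u =
     measure (dyn_space k P0)
       {(x, c) \<in> space (dyn_space k P0). \<forall>t\<le>T. spin k u x c t [] = s t}"

definition spin_trajs :: "nat \<Rightarrow> (nat \<Rightarrow> int) set" where
  "spin_trajs T = {..T} \<rightarrow>\<^sub>E {-1, 1}"

definition root_kernel :: "nat \<Rightarrow> real \<Rightarrow> int \<Rightarrow> (nat \<Rightarrow> int) \<Rightarrow> real" where
  "root_kernel k h a b =
     (let r = real_of_int (\<Sum>i=1..k - 1. b i) + h
      in if r \<noteq> 0 then of_bool (real_of_int a = sgn r) else 1 / 2)"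

end

theory Submission
  imports Defs
begin

text \<open>Fix the root trajectory \<open>s\<close>. Each subtree hanging off the root then evolves as a copy of the
  same dynamics with external field \<open>s\<close>, the only difference being the rule for ties at the top of
  the subtree: there the coin is multiplied by the current spin. On the event that the child \<open>i\<close>
  follows a given trajectory \<open>\<sigma> i\<close> this multiplier is a deterministic sign, and flipping fair coins
  by deterministic signs preserves the measure. So the event that the root follows \<open>s\<close> splits,
  according to the trajectories of its children, into disjoint events, each of them an intersection
  of events depending on the randomness at the root and in the \<open>k - 1\<close> subtrees respectively;
  independence gives the product.\<close>

section \<open>Product measures\<close>

text \<open>The joint law of the coordinates is the law of the identity map, and it equals the
  product of the marginals; this is the product criterion for independence.\<close>

lemma indep_vars_PiM_components:
  assumes "\<And>i. i \<in> I \<Longrightarrow> prob_space (M i)" and "I \<noteq> {}"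
  shows "prob_space.indep_vars (PiM I M) M (\<lambda>i x. x i) I"
proof -
  interpret P: prob_space "PiM I M" by (rule prob_space_PiM) fact
  have "distr (PiM I M) (PiM I M) (\<lambda>x. \<lambda>i\<in>I. x i) = distr (PiM I M) (PiM I M) (\<lambda>x. x)"
    by (rule distr_cong) (auto simp: space_PiM)
  also have "\<dots> = PiM I (\<lambda>i. distr (PiM I M) (M i) (\<lambda>x. x i))"
    by (simp add: distr_PiM_component assms cong: PiM_cong)
  finally show ?thesis
    by (subst P.indep_vars_iff_distr_eq_PiM') (auto simp: assms)
qed

text \<open>Passing to a subtree means selecting coordinates through \<open>f\<close> and altering
  each by a law-preserving map \<open>h j\<close>. Injectivity of \<open>f\<close> keeps the
  selected coordinates independent, so the law is computed in two stages: first the reindexing, then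
  the coordinatewise maps.\<close>

lemma distr_PiM_transform:
  assumes M: "\<And>i. i \<in> I \<Longrightarrow> prob_space (M i)"
    and f: "inj_on f J" "f \<in> J \<rightarrow> I" and "J \<noteq> {}"
    and h: "\<And>j. j \<in> J \<Longrightarrow> h j \<in> M (f j) \<rightarrow>\<^sub>M N j"
      "\<And>j. j \<in> J \<Longrightarrow> distr (M (f j)) (N j) (h j) = N j"
  shows "distr (PiM I M) (PiM J N) (\<lambda>x. \<lambda>j\<in>J. h j (x (f j))) = PiM J N"
proof -
  let ?Q = "PiM J (\<lambda>j. M (f j))"
  have MJ: "prob_space (M (f j))" if "j \<in> J" for j
    using f(2) M that by auto
  interpret Q: prob_space ?Q by (rule prob_space_PiM) (rule MJ)
  have ind: "Q.indep_vars N (\<lambda>j x. h j (x j)) J"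
    by (rule Q.indep_vars_compose2[OF indep_vars_PiM_components]) (auto simp: MJ \<open>J \<noteq> {}\<close> h)
  have hm: "(\<lambda>x. h j (x j)) \<in> ?Q \<rightarrow>\<^sub>M N j" if "j \<in> J" for j
    using h(1)[OF that] that by measurable
  have "distr (PiM I M) (PiM J N) (\<lambda>x. \<lambda>j\<in>J. h j (x (f j)))
      = distr (distr (PiM I M) ?Q (\<lambda>x. \<lambda>j\<in>J. x (f j))) (PiM J N) (\<lambda>x. \<lambda>j\<in>J. h j (x j))"
  proof (subst distr_distr)
    show "(\<lambda>x. \<lambda>j\<in>J. h j (x j)) \<in> ?Q \<rightarrow>\<^sub>M PiM J N"
      by (rule measurable_restrict) (rule hm)
    show "(\<lambda>x. \<lambda>j\<in>J. x (f j)) \<in> PiM I M \<rightarrow>\<^sub>M ?Q"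
      by (intro measurable_restrict measurable_component_singleton) (use f in auto)
  qed (auto simp: comp_def intro!: distr_cong)
  also have "\<dots> = distr ?Q (PiM J N) (\<lambda>x. \<lambda>j\<in>J. h j (x j))"
    by (subst distr_PiM_reindex) (use M f in auto)
  also have "\<dots> = PiM J (\<lambda>j. distr ?Q (N j) (\<lambda>x. h j (x j)))"
    using ind by (subst (asm) Q.indep_vars_iff_distr_eq_PiM') (auto simp: hm \<open>J \<noteq> {}\<close>)
  also have "\<dots> = PiM J N"
  proof (rule PiM_cong)
    fix j assume j: "j \<in> J"
    have "distr ?Q (N j) (\<lambda>x. h j (x j)) = distr (distr ?Q (M (f j)) (\<lambda>x. x j)) (N j) (h j)"
      by (subst distr_distr) (auto simp: h comp_def j)
    also have "\<dots> = N j"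
      by (subst distr_PiM_component) (auto simp: MJ h j)
    finally show "distr ?Q (N j) (\<lambda>x. h j (x j)) = N j" .
  qed simp
  finally show ?thesis .
qed

lemma measure_PiM_Collect_finite:
  assumes "\<And>i. i \<in> I \<Longrightarrow> prob_space (M i)" and "J \<subseteq> I" "finite J" "\<And>j. j \<in> J \<Longrightarrow> A j \<in> sets (M j)"
  shows "measure (PiM I M) {x \<in> space (PiM I M). \<forall>j\<in>J. x j \<in> A j} = (\<Prod>j\<in>J. measure (M j) (A j))"
proof -
  have "{x \<in> space (PiM I M). \<forall>j\<in>J. x j \<in> A j} = prod_emb I M J (Pi\<^sub>E J A)"
    using assms(2) by (auto simp: prod_emb_def space_PiM)
  moreover have "emeasure (M j) (A j) = ennreal (measure (M j) (A j))" if "j \<in> J" for j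
  proof -
    interpret prob_space "M j" using assms that by auto
    show ?thesis by (rule emeasure_eq_measure)
  qed
  ultimately show ?thesis
    by (subst measure_def) (simp add: emeasure_PiM_emb assms prod_ennreal prod_nonneg)
qed

section \<open>Pathwise decomposition of the dynamics\<close>

lemma floor_sgn: "\<lfloor>sgn (r :: real)\<rfloor> = (if r > 0 then 1 else if r < 0 then - 1 else 0)"
  by (simp add: sgn_if floor_eq_iff)

lemma Nil_in_tree_verts [simp]: "[] \<in> tree_verts k"
  by (simp add: tree_verts_def)

lemma Cons_in_tree_verts [simp]: "i # v \<in> tree_verts k \<longleftrightarrow> i \<in> {1..k - 1} \<and> v \<in> tree_verts k"
  by (auto simp: tree_verts_def)

lemma nbrs_root: "nbrs k [] = (\<lambda>i. [i]) ` {1..k - 1}"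
  by (auto simp: nbrs_def tree_verts_def)

text \<open>Only the top vertex of a subtree has a neighbour outside it, namely the root, whose spin
  will act as the external field. At all other vertices of the subtree \<open>Cons i\<close> is an
  isomorphism onto the neighbourhoods of the subtree.\<close>

lemma nbrs_child_root: "i \<in> {1..k - 1} \<Longrightarrow> nbrs k [i] = insert [] (Cons i ` nbrs k [])"
  by (auto simp: nbrs_def tree_verts_def Cons_eq_append_conv)

lemma nbrs_Cons: "i \<in> {1..k - 1} \<Longrightarrow> w \<noteq> [] \<Longrightarrow> nbrs k (i # w) = Cons i ` nbrs k w"
  by (auto simp: nbrs_def tree_verts_def Cons_eq_append_conv image_iff append_eq_Cons_conv)

lemma finite_nbrs: "finite (nbrs k v)"
proof (rule finite_subset)
  show "nbrs k v \<subseteq> (\<lambda>i. v @ [i]) ` {1..k - 1} \<union> {butlast v}"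
    by (auto simp: nbrs_def tree_verts_def)
qed auto

text \<open>The recursion reads only vertices of the tree and coins before time \<open>t\<close>.
  This permits dropping or inserting restrictions to coordinate sets, and altering coins at later
  times.\<close>

lemma spin_cong:
  assumes "\<And>v. v \<in> tree_verts k \<Longrightarrow> x v = x' v"
    and "\<And>v t'. v \<in> tree_verts k \<Longrightarrow> t' < t \<Longrightarrow> c (v, t') = c' (v, t')"
    and "v \<in> tree_verts k"
  shows "spin k u x c t v = spin k u x' c' t v"
  using assms(2,3)
proof (induction t arbitrary: v)
  case (Suc t)
  have IH: "spin k u x c t w = spin k u x' c' t w" if "w \<in> tree_verts k" for w
    by (rule Suc.IH) (use Suc.prems that in auto)
  have "(\<Sum>w\<in>nbrs k v'. spin k u x c t w) = (\<Sum>w\<in>nbrs k v'. spin k u x' c' t w)" for v'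
    by (intro sum.cong refl IH) (auto simp: nbrs_def)
  with Suc.prems(1)[of v t] IH Suc.prems(2) show ?case by (auto simp del: of_int_sum)
qed (simp add: assms)

lemma spin_pm1:
  assumes "\<And>v. v \<in> tree_verts k \<Longrightarrow> x v \<in> {-1, 1}"
    and "\<And>v t. v \<in> tree_verts k \<Longrightarrow> c (v, t) \<in> {-1, 1}"
    and "v \<in> tree_verts k"
  shows "spin k u x c t v \<in> {-1, 1}"
  using assms(3)
proof (induction t arbitrary: v)
  case (Suc t)
  have "[] \<in> tree_verts k" by simp
  with Suc.IH[OF Suc.prems] assms(2)[OF Suc.prems, of t] assms(2)[of "[]" t] show ?case
    by (auto simp: Let_def floor_sgn sgn_if[where 'a = int] simp del: of_int_sum)
qed (use assms in auto)

text \<open>On a prescribed trajectory \<open>\<tau>\<close> of the child \<open>i\<close>, its tie-breaking rule (coin times current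
  spin) becomes that of a root (coin alone) once the coin at time \<open>t\<close> is multiplied by the
  deterministic sign \<open>\<tau> t\<close>.\<close>

definition child_coins ::
  "nat \<Rightarrow> (nat \<Rightarrow> int) \<Rightarrow> (nat list \<times> nat \<Rightarrow> int) \<Rightarrow> nat list \<times> nat \<Rightarrow> int" where
  "child_coins i \<tau> c = (\<lambda>(w, t). (if w = [] then \<tau> t else 1) * c (i # w, t))"

text \<open>The spin of the root enters the subtree only as the field \<open>s\<close>, and the sign
  change in \<open>child_coins\<close> makes the tie rules agree at the top. The hypothesis on
  \<open>\<tau>\<close> is a disjunction because the lemma serves both directions of an equivalence:
  either the child in the full tree or the root of the copy is known to follow
  \<open>\<tau>\<close>, and the induction identifies the two.\<close>

lemma spin_child:
  assumes i: "i \<in> {1..k - 1}" and w: "w \<in> tree_verts k"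
    and "\<And>t'. t' < t \<Longrightarrow> spin k u x c t' [] = s t'"
    and "\<And>t'. t' < t \<Longrightarrow> spin k u x c t' [i] = \<tau> t' \<or>
      spin k (\<lambda>t. real_of_int (s t)) (\<lambda>w. x (i # w)) (child_coins i \<tau> c) t' [] = \<tau> t'"
  shows "spin k u x c t (i # w) =
    spin k (\<lambda>t. real_of_int (s t)) (\<lambda>w. x (i # w)) (child_coins i \<tau> c) t w"
  using assms(2-)
proof (induction t arbitrary: w)
  case (Suc t)
  let ?D = "spin k (\<lambda>t. real_of_int (s t)) (\<lambda>w. x (i # w)) (child_coins i \<tau> c)"
  have IH: "spin k u x c t (i # w') = ?D t w'" if "w' \<in> tree_verts k" for w'
    using Suc.IH[OF that] Suc.prems(2,3) less_SucI by blast
  have sum: "(\<Sum>v\<in>Cons i ` nbrs k w'. spin k u x c t v) = (\<Sum>v\<in>nbrs k w'. ?D t v)" for w'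
    by (subst sum.reindex) (auto intro!: sum.cong IH simp: nbrs_def)
  show ?case
  proof (cases "w = []")
    case True
    have "[] \<notin> Cons i ` nbrs k []" by auto
    then have h: "(\<Sum>v\<in>nbrs k [i]. spin k u x c t v) = (\<Sum>v\<in>nbrs k []. ?D t v) + s t"
      by (simp add: nbrs_child_root[OF i] finite_nbrs sum Suc.prems(2))
    \<comment> \<open>Whichever alternative holds, the current spin is \<open>\<tau> t\<close>, so a
      tie at \<open>[i]\<close> yields the coin times \<open>\<tau> t\<close>, which is the coin of
      the copy.\<close>
    have "spin k u x c t [i] = \<tau> t"
      using IH[of "[]"] Suc.prems(3)[of t] by auto
    \<comment> \<open>The full tree tests an integer and the copy a real number; the two are equal,
      so signs and ties coincide.\<close>
    moreover have "real_of_int (\<Sum>v\<in>nbrs k []. ?D t v) + real_of_int (s t) =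
        real_of_int ((\<Sum>v\<in>nbrs k []. ?D t v) + s t)" by simp
    ultimately show ?thesis
      using True h by (simp add: Let_def child_coins_def floor_sgn sgn_if[where 'a = int] del: of_int_sum)
  next
    case False
    then show ?thesis
      using IH[OF Suc.prems(1)] by (simp add: nbrs_Cons[OF i] sum child_coins_def)
  qed
qed simp

text \<open>The children's spins and the coin are separate arguments: once the former are
  prescribed, the coin is the only randomness left in the update.\<close>

definition root_step :: "nat \<Rightarrow> real \<Rightarrow> int \<Rightarrow> (nat \<Rightarrow> int) \<Rightarrow> int \<Rightarrow> bool" where
  "root_step k h a b c \<longleftrightarrow>
     (let r = real_of_int (\<Sum>i=1..k - 1. b i) + h in a = (if r \<noteq> 0 then \<lfloor>sgn r\<rfloor> else c))"

lemma spin_Suc_root: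
  "spin k u x c (Suc t) [] = a \<longleftrightarrow> root_step k (u t) a (\<lambda>i. spin k u x c t [i]) (c ([], t))"
proof -
  have "(\<Sum>w\<in>nbrs k []. spin k u x c t w) = (\<Sum>i=1..k - 1. spin k u x c t [i])"
    unfolding nbrs_root by (subst sum.reindex) (auto simp: inj_on_def)
  then show ?thesis by (auto simp: root_step_def Let_def simp del: of_int_sum)
qed

lemma root_step_cong:
  "(\<And>i. i \<in> {1..k - 1} \<Longrightarrow> b i = b' i) \<Longrightarrow> root_step k h a b c = root_step k h a b' c"
  unfolding root_step_def by (metis sum.cong)

text \<open>Away from a tie the event is everything or empty; at a tie it is a single value of a
  fair coin.\<close>

lemma measure_root_step:
  assumes "a \<in> {-1, 1}"
  shows "measure_pmf.prob (pmf_of_set {-1, 1}) {c. root_step k h a b c} = root_kernel k h a b"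
proof -
  define r where "r = real_of_int (\<Sum>i=1..k - 1. b i) + h"
  have "a = \<lfloor>sgn r\<rfloor> \<longleftrightarrow> real_of_int a = sgn r"
    by (auto simp: floor_sgn)
  moreover have "measure_pmf.prob (pmf_of_set {-1, 1}) {c. a = c} = 1 / 2"
    using assms by (simp add: measure_pmf_single)
  ultimately show ?thesis
    unfolding root_step_def root_kernel_def Let_def r_def[symmetric]
    by (auto simp: of_bool_def)
qed

text \<open>On the left the root and its children influence each other. On the right the interaction
  is replaced by the constants \<open>s\<close> and \<open>\<sigma>\<close>, so the clauses involve
  disjoint randomness: that of the root, and that of each subtree.\<close>

lemma root_trajectory_iff:
  assumes \<sigma>: "\<And>i. i \<in> {1..k - 1} \<Longrightarrow> \<sigma> i \<in> spin_trajs T"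
  shows "(\<forall>t\<le>Suc T. spin k u x c t [] = s t) \<and>
      (\<forall>i\<in>{1..k - 1}. \<forall>t\<le>T. spin k u x c t [i] = \<sigma> i t) \<longleftrightarrow>
    x [] = s 0 \<and> (\<forall>t\<le>T. root_step k (u t) (s (Suc t)) (\<lambda>i. \<sigma> i t) (c ([], t))) \<and>
      (\<forall>i\<in>{1..k - 1}. \<forall>t\<le>T. spin k (\<lambda>t. real_of_int (s t)) (\<lambda>w. x (i # w))
        (child_coins i (\<sigma> i) c) t [] = \<sigma> i t)"
    (is "?L \<longleftrightarrow> ?R")
proof
  {
    assume L: ?L
    have "spin k (\<lambda>t. real_of_int (s t)) (\<lambda>w. x (i # w)) (child_coins i (\<sigma> i) c) t [] = \<sigma> i t"
      if "i \<in> {1..k - 1}" "t \<le> T" for i t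
      using spin_child[OF that(1) Nil_in_tree_verts, of t u x c s "\<sigma> i"] L that by simp
    moreover have "root_step k (u t) (s (Suc t)) (\<lambda>i. \<sigma> i t) (c ([], t))" if "t \<le> T" for t
    proof -
      have "spin k u x c (Suc t) [] = s (Suc t)" using L that by blast
      then show ?thesis unfolding spin_Suc_root
        by (rule iffD1[OF root_step_cong, rotated]) (use L that in auto)
    qed
    moreover have "x [] = s 0" using L by force
    ultimately show ?R by blast
  }
  {
    assume R: ?R
    \<comment> \<open>Here the second alternative of \<open>spin_child\<close> is the known one; the
      root is controlled only up to the time considered.\<close>
    have child: "spin k u x c t [i] = \<sigma> i t"
      if "i \<in> {1..k - 1}" "t \<le> T" "\<And>t'. t' \<le> t \<Longrightarrow> spin k u x c t' [] = s t'" for i t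
      using spin_child[OF that(1) Nil_in_tree_verts, of t u x c s "\<sigma> i"] R that by simp
    \<comment> \<open>Root and children are recovered alternately: the root up to time
      \<open>t\<close> fixes the children at \<open>t\<close>, and these fix the root at
      \<open>t + 1\<close>. Hence children are needed up to \<open>T\<close> and the root up to
      \<open>Suc T\<close>.\<close>
    have root: "\<forall>t'\<le>t. spin k u x c t' [] = s t'" if "t \<le> Suc T" for t
      using that
    proof (induction t)
      case (Suc t)
      then have IH: "\<forall>t'\<le>t. spin k u x c t' [] = s t'" and "t \<le> T" by auto
      then have "root_step k (u t) (s (Suc t)) (\<lambda>i. \<sigma> i t) (c ([], t))" using R by blast
      then have "spin k u x c (Suc t) [] = s (Suc t)" unfolding spin_Suc_root
        by (rule iffD1[OF root_step_cong, rotated]) (use child IH \<open>t \<le> T\<close> in auto)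
      with IH show ?case by (auto simp: le_Suc_eq)
    qed (use R in simp)
    have "spin k u x c t [i] = \<sigma> i t" if "i \<in> {1..k - 1}" "t \<le> T" for i t
      by (rule child[OF that]) (use root[of t] that in auto)
    with root show ?L by blast
  }
qed

section \<open>Probabilities of trajectories\<close>

lemma measurable_count_space_binary:
  fixes f :: "'a \<Rightarrow> 'b :: countable" and g :: "'a \<Rightarrow> 'c :: countable"
  assumes f: "f \<in> M \<rightarrow>\<^sub>M count_space UNIV" and g: "g \<in> M \<rightarrow>\<^sub>M count_space UNIV"
  shows "(\<lambda>x. F (f x) (g x)) \<in> M \<rightarrow>\<^sub>M count_space UNIV"
proof (rule measurable_compose_countable[OF _ f])
  show "(\<lambda>x. F a (g x)) \<in> M \<rightarrow>\<^sub>M count_space UNIV" for a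
    by (rule measurable_compose[OF g]) simp
qed

lemma measurable_sum_count_space:
  fixes f :: "'i \<Rightarrow> 'a \<Rightarrow> 'b :: {comm_monoid_add, countable}"
  assumes "\<And>i. i \<in> I \<Longrightarrow> f i \<in> M \<rightarrow>\<^sub>M count_space UNIV"
  shows "(\<lambda>x. \<Sum>i\<in>I. f i x) \<in> M \<rightarrow>\<^sub>M count_space UNIV"
  using assms
proof (induction I rule: infinite_finite_induct)
  case (insert i I)
  have "(\<lambda>x. f i x + (\<Sum>i\<in>I. f i x)) \<in> M \<rightarrow>\<^sub>M count_space UNIV"
    by (rule measurable_count_space_binary) (use insert in auto)
  with insert show ?case by simp
qed auto

text \<open>Initial spins and coins are arbitrary random functions of \<open>\<omega>\<close>, so
  that the result applies on the original space, on the flat product, and on the block of a single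
  subtree.\<close>

lemma measurable_spin:
  assumes "\<And>v. v \<in> tree_verts k \<Longrightarrow> (\<lambda>\<omega>. x \<omega> v) \<in> M \<rightarrow>\<^sub>M count_space UNIV"
    and "\<And>v t. v \<in> tree_verts k \<Longrightarrow> (\<lambda>\<omega>. c \<omega> (v, t)) \<in> M \<rightarrow>\<^sub>M count_space UNIV"
    and "v \<in> tree_verts k"
  shows "(\<lambda>\<omega>. spin k u (x \<omega>) (c \<omega>) t v) \<in> M \<rightarrow>\<^sub>M count_space UNIV"
  using assms(3)
proof (induction t arbitrary: v)
  case (Suc t)
  have h: "(\<lambda>\<omega>. \<Sum>w\<in>nbrs k v'. spin k u (x \<omega>) (c \<omega>) t w) \<in> M \<rightarrow>\<^sub>M count_space UNIV" for v'
    by (rule measurable_sum_count_space) (auto intro!: Suc.IH simp: nbrs_def)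
  \<comment> \<open>One update as a function of the neighbour sum, the current spin and the coin.
    These are integers, so any such \<open>F\<close> preserves measurability.\<close>
  define F where "F a b d = (if v = [] then
        let h = real_of_int a + u t in if h \<noteq> 0 then \<lfloor>sgn h\<rfloor> else d
      else if a \<noteq> 0 then sgn a else d * b)" for a b d :: int
  have "(\<lambda>\<omega>. F (\<Sum>w\<in>nbrs k v. spin k u (x \<omega>) (c \<omega>) t w) (spin k u (x \<omega>) (c \<omega>) t v) (c \<omega> (v, t)))
      \<in> M \<rightarrow>\<^sub>M count_space UNIV"
    by (rule measurable_count_space_binary[where F = "\<lambda>p d. F (fst p) (snd p) d"
          and f = "\<lambda>\<omega>. (\<Sum>w\<in>nbrs k v. spin k u (x \<omega>) (c \<omega>) t w, spin k u (x \<omega>) (c \<omega>) t v)", simplified])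
      (use h Suc assms(2) in \<open>auto intro: measurable_count_space_binary\<close>)
  also have "(\<lambda>\<omega>. F (\<Sum>w\<in>nbrs k v. spin k u (x \<omega>) (c \<omega>) t w) (spin k u (x \<omega>) (c \<omega>) t v) (c \<omega> (v, t)))
      = (\<lambda>\<omega>. spin k u (x \<omega>) (c \<omega>) (Suc t) v)"
    by (auto simp: F_def Let_def fun_eq_iff simp del: of_int_sum)
  finally show ?case .
qed (use assms in simp)

section \<open>The flat product over all initial spins and coins\<close>

definition coords :: "nat \<Rightarrow> (nat list + nat list \<times> nat) set" where
  "coords k = tree_verts k <+> tree_verts k \<times> UNIV"

definition coord_measure :: "int pmf \<Rightarrow> nat list + nat list \<times> nat \<Rightarrow> int measure" where
  "coord_measure P0 = case_sum (\<lambda>_. measure_pmf P0) (\<lambda>_. measure_pmf (pmf_of_set {-1, 1}))"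

text \<open>A single product over all coordinates, initial spins and coins together, so that independence
  of subtrees is independence of disjoint blocks of coordinates.\<close>

definition flat_space :: "nat \<Rightarrow> int pmf \<Rightarrow> (nat list + nat list \<times> nat \<Rightarrow> int) measure" where
  "flat_space k P0 = PiM (coords k) (coord_measure P0)"

lemma coords_simps [simp]:
  "Inl v \<in> coords k \<longleftrightarrow> v \<in> tree_verts k" "Inr (v, t) \<in> coords k \<longleftrightarrow> v \<in> tree_verts k"
  by (auto simp: coords_def)

lemma coord_measure_simps [simp]:
  "coord_measure P0 (Inl v) = measure_pmf P0"
  "coord_measure P0 (Inr e) = measure_pmf (pmf_of_set {-1, 1})"
  by (simp_all add: coord_measure_def)

lemma sets_coord_measure [simp, measurable_cong]: "sets (coord_measure P0 j) = sets (count_space UNIV)"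
  by (cases j) auto

lemma space_coord_measure [simp]: "space (coord_measure P0 j) = UNIV"
  by (cases j) auto

lemma prob_space_coord_measure: "prob_space (coord_measure P0 j)"
  by (cases j) (auto simp: measure_pmf.prob_space_axioms)

lemma prob_space_flat_space: "prob_space (flat_space k P0)"
  unfolding flat_space_def by (rule prob_space_PiM) (rule prob_space_coord_measure)

lemma measurable_coord:
  "j \<in> J \<Longrightarrow> (\<lambda>z. z j) \<in> PiM J (coord_measure P0) \<rightarrow>\<^sub>M count_space UNIV"
  using measurable_component_singleton[of j J "coord_measure P0"]
  by (simp cong: measurable_cong_sets)

lemma coords_nonempty [simp]: "coords k \<noteq> {}"
proof -
  have "Inl [] \<in> coords k" by simp
  then show ?thesis by blast
qed

lemma indep_coords:
  "prob_space.indep_vars (flat_space k P0) (coord_measure P0) (\<lambda>j z. z j) (coords k)"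
  unfolding flat_space_def by (intro indep_vars_PiM_components prob_space_coord_measure coords_nonempty)

text \<open>Initial spins and coins form disjoint blocks of coordinates of the flat product. They
  are therefore independent, and their joint law is the product of the two infinite
  products.\<close>

lemma dyn_space_eq_distr:
  "dyn_space k P0 = distr (flat_space k P0) (dyn_space k P0)
     (\<lambda>z. (\<lambda>v\<in>tree_verts k. z (Inl v), \<lambda>e\<in>tree_verts k \<times> UNIV. z (Inr e)))"
proof -
  let ?N = "flat_space k P0" and ?V = "tree_verts k" and ?E = "tree_verts k \<times> (UNIV :: nat set)"
  let ?X = "\<Pi>\<^sub>M v\<in>?V. measure_pmf P0" and ?C = "\<Pi>\<^sub>M e\<in>?E. measure_pmf (pmf_of_set {-1, 1 :: int})"
  let ?S = "PiM (Inl ` ?V) (coord_measure P0)" and ?T = "PiM (Inr ` ?E) (coord_measure P0)"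
  let ?f = "\<lambda>y. \<lambda>v\<in>?V. y (Inl v)" and ?g = "\<lambda>y. \<lambda>e\<in>?E. y (Inr e)"
  interpret N: prob_space ?N by (rule prob_space_flat_space)
  have V: "Inl ` ?V \<subseteq> coords k" "Inr ` ?E \<subseteq> coords k" by (auto simp: coords_def)
  \<comment> \<open>Independence of a pair is expressed through a family indexed by
    \<open>bool\<close>.\<close>
  let ?K = "case_bool (Inl ` ?V) (Inr ` ?E)"
  have "N.indep_vars (\<lambda>b. PiM (?K b) (coord_measure P0)) (\<lambda>b z. restrict z (?K b)) UNIV"
    by (rule N.indep_vars_restrict[OF indep_coords]) (use V in \<open>auto simp: disjoint_family_on_def split: bool.splits\<close>)
  moreover have "(\<lambda>b. PiM (?K b) (coord_measure P0)) = case_bool ?S ?T"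
    "(\<lambda>b (z :: nat list + nat list \<times> nat \<Rightarrow> int). restrict z (?K b)) = case_bool (\<lambda>z. restrict z (Inl ` ?V)) (\<lambda>z. restrict z (Inr ` ?E))"
    by (auto simp: fun_eq_iff split: bool.splits)
  ultimately have "N.indep_var ?S (\<lambda>z. restrict z (Inl ` ?V)) ?T (\<lambda>z. restrict z (Inr ` ?E))"
    unfolding N.indep_var_def by (simp only:)
  then have ST: "(\<lambda>z. (restrict z (Inl ` ?V), restrict z (Inr ` ?E))) \<in> ?N \<rightarrow>\<^sub>M ?S \<Otimes>\<^sub>M ?T"
    "distr ?N ?S (\<lambda>z. restrict z (Inl ` ?V)) \<Otimes>\<^sub>M distr ?N ?T (\<lambda>z. restrict z (Inr ` ?E))
      = distr ?N (?S \<Otimes>\<^sub>M ?T) (\<lambda>z. (restrict z (Inl ` ?V), restrict z (Inr ` ?E)))"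
    unfolding N.indep_var_distribution_eq by (auto intro: measurable_Pair)
  have restr: "distr ?N (PiM I (coord_measure P0)) (\<lambda>z. restrict z I) = PiM I (coord_measure P0)"
    if "I \<subseteq> coords k" for I
    using distr_PiM_reindex[of "coords k" "coord_measure P0" "\<lambda>j. j" I] that
    unfolding flat_space_def by (auto simp: prob_space_coord_measure)
  have X: "?X = distr ?S ?X ?f"
    using distr_PiM_reindex[of "Inl ` ?V" "coord_measure P0" Inl ?V]
    by (auto simp: prob_space_coord_measure)
  have C: "?C = distr ?T ?C ?g"
    using distr_PiM_reindex[of "Inr ` ?E" "coord_measure P0" Inr ?E]
    by (auto simp: prob_space_coord_measure)
  have f: "?f \<in> ?S \<rightarrow>\<^sub>M ?X" and g: "?g \<in> ?T \<rightarrow>\<^sub>M ?C"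
    by (auto intro!: measurable_restrict measurable_coord cong: measurable_cong_sets)
  have "prob_space ?C"
    by (rule prob_space_PiM) (rule measure_pmf.prob_space_axioms)
  then have sf: "sigma_finite_measure (distr ?T ?C ?g)"
    unfolding C[symmetric] by (simp add: prob_space_imp_sigma_finite)
  have "dyn_space k P0 = distr ?S ?X ?f \<Otimes>\<^sub>M distr ?T ?C ?g"
    unfolding dyn_space_def using X C by simp
  also have "\<dots> = distr (?S \<Otimes>\<^sub>M ?T) (?X \<Otimes>\<^sub>M ?C) (\<lambda>(x, y). (?f x, ?g y))"
    by (rule pair_measure_distr[OF f g sf])
  also have "?S \<Otimes>\<^sub>M ?T = distr ?N (?S \<Otimes>\<^sub>M ?T) (\<lambda>z. (restrict z (Inl ` ?V), restrict z (Inr ` ?E)))"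
    using ST(2) restr[OF V(1)] restr[OF V(2)] by simp
  also have "distr \<dots> (?X \<Otimes>\<^sub>M ?C) (\<lambda>(x, y). (?f x, ?g y)) =
      distr ?N (?X \<Otimes>\<^sub>M ?C) ((\<lambda>(x, y). (?f x, ?g y)) \<circ> (\<lambda>z. (restrict z (Inl ` ?V), restrict z (Inr ` ?E))))"
  proof (rule distr_distr[OF _ ST(1)])
    show "(\<lambda>(x, y). (?f x, ?g y)) \<in> ?S \<Otimes>\<^sub>M ?T \<rightarrow>\<^sub>M ?X \<Otimes>\<^sub>M ?C"
      using f g by measurable
  qed
  also have "\<dots> = distr ?N (dyn_space k P0) (\<lambda>z. (?f z, ?g z))"
    by (rule distr_cong) (auto simp: dyn_space_def fun_eq_iff restrict_def)
  finally show ?thesis .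
qed

lemma traj_prob_flat:
  "traj_prob k P0 T s u = measure (flat_space k P0)
     {z \<in> space (flat_space k P0). \<forall>t\<le>T. spin k u (\<lambda>v. z (Inl v)) (\<lambda>e. z (Inr e)) t [] = s t}"
proof -
  let ?g = "\<lambda>z. (\<lambda>v\<in>tree_verts k. z (Inl v), \<lambda>e\<in>tree_verts k \<times> UNIV. z (Inr e))"
  let ?D = "dyn_space k P0" and ?N = "flat_space k P0"
  let ?A = "{(x, c) \<in> space ?D. \<forall>t\<le>T. spin k u x c t [] = s t}"
  have g: "?g \<in> ?N \<rightarrow>\<^sub>M ?D"
    unfolding dyn_space_def flat_space_def
    by (intro measurable_Pair measurable_restrict) (auto intro!: measurable_coord simp: cong: measurable_cong_sets)
  have [measurable]: "(\<lambda>\<omega>. spin k u (fst \<omega>) (snd \<omega>) t []) \<in> ?D \<rightarrow>\<^sub>M count_space UNIV" for t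
    by (rule measurable_spin) (auto simp: dyn_space_def)
  have "{\<omega> \<in> space ?D. \<forall>t\<le>T. spin k u (fst \<omega>) (snd \<omega>) t [] = s t} \<in> sets ?D"
    by measurable
  also have "{\<omega> \<in> space ?D. \<forall>t\<le>T. spin k u (fst \<omega>) (snd \<omega>) t [] = s t} = ?A" by auto
  finally have "measure ?D ?A = measure ?N (?g -` ?A \<inter> space ?N)"
    by (subst dyn_space_eq_distr, subst measure_distr) (auto simp: g)
  also have "?g -` ?A \<inter> space ?N =
      {z \<in> space ?N. \<forall>t\<le>T. spin k u (\<lambda>v. z (Inl v)) (\<lambda>e. z (Inr e)) t [] = s t}"
  proof -
    have "spin k u (\<lambda>v\<in>tree_verts k. z (Inl v)) (\<lambda>e\<in>tree_verts k \<times> UNIV. z (Inr e)) t [] =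
        spin k u (\<lambda>v. z (Inl v)) (\<lambda>e. z (Inr e)) t []" for z t
      by (rule spin_cong) auto
    then show ?thesis using measurable_space[OF g] by auto
  qed
  finally show ?thesis unfolding traj_prob_def .
qed

section \<open>Events in one subtree and events at the root\<close>

lemma distr_coin_flip:
  assumes "a \<in> {-1, 1 :: int}"
  shows "distr (measure_pmf (pmf_of_set {-1, 1})) (measure_pmf (pmf_of_set {-1, 1})) (\<lambda>y. a * y)
    = measure_pmf (pmf_of_set {-1, 1})"
proof -
  have "map_pmf (\<lambda>y. a * y) (pmf_of_set {-1, 1}) = pmf_of_set ((\<lambda>y. a * y) ` {-1, 1})"
    by (rule map_pmf_of_set_inj) (use assms in auto)
  also have "(\<lambda>y. a * y) ` {-1, 1} = {-1, 1}" using assms by auto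
  finally have "measure_pmf (map_pmf (\<lambda>y. a * y) (pmf_of_set {-1, 1})) = measure_pmf (pmf_of_set {-1, 1})"
    by simp
  moreover have "distr (measure_pmf (pmf_of_set {-1, 1})) (measure_pmf (pmf_of_set {-1, 1})) (\<lambda>y. a * y)
      = distr (measure_pmf (pmf_of_set {-1, 1})) (count_space UNIV) (\<lambda>y. a * y)"
    by (rule distr_cong) auto
  ultimately show ?thesis
    by (simp add: map_pmf_rep_eq)
qed

text \<open>Reading off the coordinates of the subtree at \<open>i\<close>, with the coins at its
  top flipped by \<open>\<tau>\<close>, is a measure-preserving map of the flat space to itself. The
  event is the preimage under this map of the root trajectory event.\<close>

lemma measure_child_trajectory:
  assumes i: "i \<in> {1..k - 1}" and \<tau>: "\<And>t. \<tau> t \<in> {-1, 1}"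
  shows "measure (flat_space k P0) {z \<in> space (flat_space k P0). \<forall>t\<le>T.
      spin k u (\<lambda>w. z (Inl (i # w))) (child_coins i \<tau> (\<lambda>e. z (Inr e))) t [] = s t}
    = traj_prob k P0 T s u"
proof -
  let ?N = "flat_space k P0"
  \<comment> \<open>The embedding of the whole tree onto the subtree at \<open>i\<close>, applied to
    spin and coin coordinates alike.\<close>
  define f :: "nat list + nat list \<times> nat \<Rightarrow> nat list + nat list \<times> nat"
    where "f = map_sum (Cons i) (apfst (Cons i))"
  \<comment> \<open>The identity except on the coins at the top. All times occur in the product, so
    \<open>\<tau> t\<close> has to be a sign for every \<open>t\<close>.\<close>
  define h :: "nat list + nat list \<times> nat \<Rightarrow> int \<Rightarrow> int"
    where "h = case_sum (\<lambda>_ y. y) (\<lambda>(w, t) y. (if w = [] then \<tau> t else 1) * y)"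
  let ?g = "\<lambda>z. \<lambda>j\<in>coords k. h j (z (f j))"
  have N: "distr ?N ?N ?g = ?N"
    unfolding flat_space_def
  proof (rule distr_PiM_transform)
    show "inj_on f (coords k)"
      by (auto simp: f_def inj_on_def coords_def)
    show "f \<in> coords k \<rightarrow> coords k" using i by (auto simp: f_def coords_def)
    show "coords k \<noteq> {}" by simp
    show "h j \<in> coord_measure P0 (f j) \<rightarrow>\<^sub>M coord_measure P0 j" for j
      by (simp cong: measurable_cong_sets)
    show "distr (coord_measure P0 (f j)) (coord_measure P0 j) (h j) = coord_measure P0 j" for j
    proof (cases j)
      case (Inr e)
      obtain w t where e: "e = (w, t)" by (cases e)
      show ?thesis using distr_coin_flip[of "if w = [] then \<tau> t else 1"] \<tau>[of t]
        by (simp add: Inr e f_def h_def)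
    qed (simp add: f_def h_def distr_id2)
  qed (rule prob_space_coord_measure)
  have g: "?g \<in> ?N \<rightarrow>\<^sub>M ?N"
    unfolding flat_space_def
    by (intro measurable_restrict)
      (use i in \<open>auto intro!: measurable_compose[OF measurable_coord] simp: f_def coords_def
        cong: measurable_cong_sets\<close>)
  let ?A = "{z \<in> space ?N. \<forall>t\<le>T. spin k u (\<lambda>v. z (Inl v)) (\<lambda>e. z (Inr e)) t [] = s t}"
  have [measurable]: "(\<lambda>z. spin k u (\<lambda>v. z (Inl v)) (\<lambda>e. z (Inr e)) t []) \<in> ?N \<rightarrow>\<^sub>M count_space UNIV" for t
    unfolding flat_space_def by (rule measurable_spin) (auto intro: measurable_coord)
  have "?A \<in> sets ?N" by measurable
  then have "measure ?N ?A = measure ?N (?g -` ?A \<inter> space ?N)"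
    by (subst N[symmetric], subst measure_distr) (auto simp: g)
  also have "?g -` ?A \<inter> space ?N = {z \<in> space ?N. \<forall>t\<le>T.
      spin k u (\<lambda>w. z (Inl (i # w))) (child_coins i \<tau> (\<lambda>e. z (Inr e))) t [] = s t}"
  proof -
    have "spin k u (\<lambda>v. ?g z (Inl v)) (\<lambda>e. ?g z (Inr e)) t [] =
      spin k u (\<lambda>w. z (Inl (i # w))) (child_coins i \<tau> (\<lambda>e. z (Inr e))) t []" for z t
      by (rule spin_cong) (auto simp: f_def h_def child_coins_def)
    then show ?thesis using measurable_space[OF g] by auto
  qed
  finally show ?thesis by (simp add: traj_prob_flat)
qed

text \<open>With \<open>\<sigma>\<close> prescribed, each condition concerns a different coordinate,
  so the event is a finite-dimensional cylinder and its probability a product.\<close>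

lemma measure_root_steps:
  assumes "\<And>t. t \<le> T \<Longrightarrow> s (Suc t) \<in> {-1, 1}"
  shows "measure (flat_space k P0) {z \<in> space (flat_space k P0). z (Inl []) = s 0 \<and>
      (\<forall>t\<le>T. root_step k (u t) (s (Suc t)) (\<lambda>i. \<sigma> i t) (z (Inr ([], t))))}
    = pmf P0 (s 0) * (\<Prod>t\<le>T. root_kernel k (u t) (s (Suc t)) (\<lambda>i. \<sigma> i t))"
proof -
  let ?R = "\<lambda>t. {c. root_step k (u t) (s (Suc t)) (\<lambda>i. \<sigma> i t) c}"
  define A :: "nat list + nat list \<times> nat \<Rightarrow> int set"
    where "A = case_sum (\<lambda>_. {s 0}) (\<lambda>(_, t). ?R t)"
  let ?J = "insert (Inl []) ((\<lambda>t. Inr ([], t)) ` {..T}) :: (nat list + nat list \<times> nat) set"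
  have "measure (flat_space k P0) {z \<in> space (flat_space k P0). \<forall>j\<in>?J. z j \<in> A j}
      = (\<Prod>j\<in>?J. measure (coord_measure P0 j) (A j))"
    unfolding flat_space_def
    by (rule measure_PiM_Collect_finite) (auto simp: prob_space_coord_measure)
  also have "\<dots> = pmf P0 (s 0) * (\<Prod>t\<le>T. root_kernel k (u t) (s (Suc t)) (\<lambda>i. \<sigma> i t))"
    using assms by (subst prod.insert)
      (auto simp: A_def prod.reindex inj_on_def measure_root_step measure_pmf_single)
  also have "{z \<in> space (flat_space k P0). \<forall>j\<in>?J. z j \<in> A j} = {z \<in> space (flat_space k P0). z (Inl []) = s 0 \<and>
      (\<forall>t\<le>T. root_step k (u t) (s (Suc t)) (\<lambda>i. \<sigma> i t) (z (Inr ([], t))))}"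
    by (auto simp: A_def)
  finally show ?thesis .
qed

section \<open>Independence of the root and the subtrees\<close>

definition block :: "nat list + nat list \<times> nat \<Rightarrow> nat" where
  "block j = (case case_sum (\<lambda>v. v) fst j of [] \<Rightarrow> 0 | i # _ \<Rightarrow> i)"

text \<open>Block 0 consists of the root coordinates and block \<open>i\<close> of those in the
  subtree at \<open>i\<close>; child labels start at 1, so there is no clash. Restrictions to
  disjoint blocks are independent, and the second hypothesis says that \<open>Q i\<close> is decided
  by block \<open>i\<close>.\<close>

lemma prob_blocks:
  assumes sets: "\<And>i. i \<le> n \<Longrightarrow>
      {y \<in> space (PiM {j \<in> coords k. block j = i} (coord_measure P0)). Q i y}
        \<in> sets (PiM {j \<in> coords k. block j = i} (coord_measure P0))"
    and Q: "\<And>i z. i \<le> n \<Longrightarrow> Q i (restrict z {j \<in> coords k. block j = i}) = Q i z"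
  shows "measure (flat_space k P0) {z \<in> space (flat_space k P0). \<forall>i\<le>n. Q i z}
    = (\<Prod>i\<le>n. measure (flat_space k P0) {z \<in> space (flat_space k P0). Q i z})"
proof -
  let ?N = "flat_space k P0" and ?K = "\<lambda>i. {j \<in> coords k. block j = i}"
  let ?X = "\<lambda>i z. restrict z (?K i)" and ?A = "\<lambda>i. {y \<in> space (PiM (?K i) (coord_measure P0)). Q i y}"
  interpret N: prob_space ?N by (rule prob_space_flat_space)
  have "N.indep_vars (\<lambda>i. PiM (?K i) (coord_measure P0)) (\<lambda>i z. ?X i z) {..n}"
    by (rule N.indep_vars_restrict[OF indep_coords]) (auto simp: disjoint_family_on_def)
  then have "N.prob (\<Inter>i\<in>{..n}. ?X i -` ?A i \<inter> space ?N) = (\<Prod>i\<le>n. N.prob (?X i -` ?A i \<inter> space ?N))"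
    by (rule N.indep_varsD) (use sets in auto)
  moreover have eq: "?X i -` ?A i \<inter> space ?N = {z \<in> space ?N. Q i z}" if "i \<le> n" for i
    using Q[OF that] by (auto simp: space_PiM)
  moreover have "(\<Inter>i\<in>{..n}. ?X i -` ?A i \<inter> space ?N) = (\<Inter>i\<in>{..n}. {z \<in> space ?N. Q i z})"
    by (rule INF_cong[OF refl]) (use eq in auto)
  moreover have "(\<Inter>i\<in>{..n}. {z \<in> space ?N. Q i z}) = {z \<in> space ?N. \<forall>i\<le>n. Q i z}"
    by auto
  moreover have "(\<Prod>i\<le>n. N.prob (?X i -` ?A i \<inter> space ?N)) = (\<Prod>i\<le>n. N.prob {z \<in> space ?N. Q i z})"
    by (rule prod.cong[OF refl]) (use eq in auto)
  ultimately show ?thesis by (simp only:)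
qed

text \<open>The coordinates range over all integers, so sign values hold only almost surely.
  Countability of the coordinates allows the quantifier inside.\<close>

lemma AE_flat_space_pm1:
  assumes "set_pmf P0 \<subseteq> {-1, 1}"
  shows "AE z in flat_space k P0. \<forall>j\<in>coords k. z j \<in> {-1, 1}"
proof -
  have "AE y in coord_measure P0 j. y \<in> {-1, 1}" for j
  proof (cases j)
    case (Inl v)
    show ?thesis unfolding Inl coord_measure_simps AE_measure_pmf_iff using assms by auto
  next
    case (Inr e)
    show ?thesis unfolding Inr coord_measure_simps AE_measure_pmf_iff by auto
  qed
  then have "AE z in flat_space k P0. z j \<in> {-1, 1}" if "j \<in> coords k" for j
    unfolding flat_space_def using that
    by (intro AE_PiM_component) (auto simp: prob_space_coord_measure)
  then show ?thesis by (simp add: AE_ball_countable)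
qed

lemma measure_conditioned_root:
  assumes s: "\<And>t. t \<le> T \<Longrightarrow> s (Suc t) \<in> {-1, 1}"
    and \<sigma>: "\<And>i. i \<in> {1..k - 1} \<Longrightarrow> \<sigma> i \<in> spin_trajs T"
  shows "measure (flat_space k P0) {z \<in> space (flat_space k P0).
      z (Inl []) = s 0 \<and> (\<forall>t\<le>T. root_step k (u t) (s (Suc t)) (\<lambda>i. \<sigma> i t) (z (Inr ([], t)))) \<and>
      (\<forall>i\<in>{1..k - 1}. \<forall>t\<le>T. spin k (\<lambda>t. real_of_int (s t)) (\<lambda>w. z (Inl (i # w)))
        (child_coins i (\<sigma> i) (\<lambda>e. z (Inr e))) t [] = \<sigma> i t)}
    = pmf P0 (s 0) * (\<Prod>t\<le>T. root_kernel k (u t) (s (Suc t)) (\<lambda>i. \<sigma> i t)) *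
      (\<Prod>i=1..k - 1. traj_prob k P0 T (\<sigma> i) (\<lambda>t. real_of_int (s t)))"
proof -
  let ?N = "flat_space k P0" and ?B = "\<lambda>i. {j \<in> coords k. block j = i}"
  let ?M = "\<lambda>i. PiM (?B i) (coord_measure P0)"
  let ?R = "\<lambda>z :: nat list + nat list \<times> nat \<Rightarrow> int. z (Inl []) = s 0 \<and>
    (\<forall>t\<le>T. root_step k (u t) (s (Suc t)) (\<lambda>i. \<sigma> i t) (z (Inr ([], t))))"
  let ?D = "\<lambda>i z. spin k (\<lambda>t. real_of_int (s t)) (\<lambda>w. z (Inl (i # w)))
        (child_coins i (\<sigma> i) (\<lambda>e. z (Inr e)))"
  let ?C = "\<lambda>i z. \<forall>t\<le>T. ?D i z t [] = \<sigma> i t"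
  \<comment> \<open>The root event takes index 0, so that a single family covers the root and all
    subtrees.\<close>
  define Q where "Q i z \<longleftrightarrow> (if i = 0 then ?R z else ?C i z)" for i z
  have Q0: "Q 0 = ?R" and Qi: "i \<in> {1..k - 1} \<Longrightarrow> Q i = ?C i" for i
    by (auto simp: Q_def)
  have split: "{..k - 1} = insert 0 {1..k - 1}" by auto
  have cong: "Q i (restrict z (?B i)) = Q i z" if "i \<le> k - 1" for i z
  proof (cases "i = 0")
    case True
    then show ?thesis by (simp add: Q0 block_def)
  next
    case False
    then have i: "i \<in> {1..k - 1}" using that by simp
    have "?D i (restrict z (?B i)) t [] = ?D i z t []" for t
      by (rule spin_cong) (use i in \<open>auto simp: child_coins_def block_def\<close>)
    then show ?thesis by (simp add: Qi[OF i])
  qed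
  have sets: "{y \<in> space (?M i). Q i y} \<in> sets (?M i)" if "i \<le> k - 1" for i
  proof (cases "i = 0")
    case True
    have [measurable]: "(\<lambda>z. z (Inl [])) \<in> ?M 0 \<rightarrow>\<^sub>M count_space UNIV"
      "(\<lambda>z. z (Inr ([], t))) \<in> ?M 0 \<rightarrow>\<^sub>M count_space UNIV" for t
      by (auto intro!: measurable_coord simp: block_def)
    show ?thesis unfolding True Q0 by measurable
  next
    case False
    then have i: "i \<in> {1..k - 1}" using that by simp
    have [measurable]: "(\<lambda>z. ?D i z t []) \<in> ?M i \<rightarrow>\<^sub>M count_space UNIV" for t
    proof (rule measurable_spin)
      show "(\<lambda>z. z (Inl (i # v))) \<in> ?M i \<rightarrow>\<^sub>M count_space UNIV" if "v \<in> tree_verts k" for v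
        by (rule measurable_coord) (use i that in \<open>auto simp: block_def\<close>)
      show "(\<lambda>z. child_coins i (\<sigma> i) (\<lambda>e. z (Inr e)) (v, t)) \<in> ?M i \<rightarrow>\<^sub>M count_space UNIV"
        if "v \<in> tree_verts k" for v t
      proof -
        have "(\<lambda>z. z (Inr (i # v, t))) \<in> ?M i \<rightarrow>\<^sub>M count_space UNIV"
          by (rule measurable_coord) (use i that in \<open>auto simp: block_def\<close>)
        from measurable_compose[OF this, of "\<lambda>y. (if v = [] then \<sigma> i t else 1) * y"]
        show ?thesis by (simp add: child_coins_def)
      qed
    qed simp
    show ?thesis unfolding Qi[OF i] by measurable
  qed
  have child: "measure ?N {z \<in> space ?N. Q i z} = traj_prob k P0 T (\<sigma> i) (\<lambda>t. real_of_int (s t))"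
    if i: "i \<in> {1..k - 1}" for i
  proof -
    \<comment> \<open>Beyond \<open>T\<close> the extensional function \<open>\<sigma> i\<close> is
      \<open>undefined\<close>. The value 1 makes it a sign at all times, and spins up to time
      \<open>T\<close> read no coin at time \<open>T\<close> or later.\<close>
    define \<tau> where "\<tau> t = (if t \<le> T then \<sigma> i t else 1)" for t
    have \<tau>: "\<tau> t \<in> {-1, 1}" for t
      using \<sigma>[OF i] by (auto simp: \<tau>_def spin_trajs_def)
    have "?D i z t [] = spin k (\<lambda>t. real_of_int (s t)) (\<lambda>w. z (Inl (i # w)))
        (child_coins i \<tau> (\<lambda>e. z (Inr e))) t []" if "t \<le> T" for z t
      by (rule spin_cong) (use that in \<open>auto simp: child_coins_def \<tau>_def\<close>)
    then show ?thesis
      unfolding Qi[OF i] using measure_child_trajectory[OF i \<tau>] by (simp cong: conj_cong)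
  qed
  have "measure ?N {z \<in> space ?N. \<forall>i\<le>k - 1. Q i z} = (\<Prod>i\<le>k - 1. measure ?N {z \<in> space ?N. Q i z})"
    by (rule prob_blocks) (fact sets cong)+
  also have "\<dots> = measure ?N {z \<in> space ?N. ?R z} *
      (\<Prod>i=1..k - 1. traj_prob k P0 T (\<sigma> i) (\<lambda>t. real_of_int (s t)))"
    unfolding split by (simp add: child Q0)
  also have "measure ?N {z \<in> space ?N. ?R z} =
      pmf P0 (s 0) * (\<Prod>t\<le>T. root_kernel k (u t) (s (Suc t)) (\<lambda>i. \<sigma> i t))"
    by (rule measure_root_steps) (rule s)
  also have "{z \<in> space ?N. \<forall>i\<le>k - 1. Q i z} = {z \<in> space ?N. ?R z \<and> (\<forall>i\<in>{1..k - 1}. ?C i z)}"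
  proof -
    have "(\<forall>i\<le>k - 1. Q i z) \<longleftrightarrow> (\<forall>i\<in>insert 0 {1..k - 1}. Q i z)" for z
      unfolding split[symmetric] by (simp only: Ball_def atMost_iff)
    then show ?thesis by (auto simp: Q0 Qi)
  qed
  finally show ?thesis by simp
qed

section \<open>Summation over the trajectories of the children\<close>

lemma finite_spin_trajs: "finite (spin_trajs T)"
  unfolding spin_trajs_def by (intro finite_PiE) auto

theorem lemma2p1:
  fixes k T :: nat and P0 :: "int pmf" and u :: "nat \<Rightarrow> real" and s :: "nat \<Rightarrow> int"
  assumes "k \<ge> 2"
    and "set_pmf P0 \<subseteq> {-1, 1}"
    and "\<And>t. t \<le> T + 1 \<Longrightarrow> s t \<in> {-1, 1}"
  shows "traj_prob k P0 (T + 1) s u =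
    pmf P0 (s 0) *
      (\<Sum>\<sigma> \<in> {1..k - 1} \<rightarrow>\<^sub>E spin_trajs T.
         (\<Prod>t = 0..T. root_kernel k (u t) (s (t + 1)) (\<lambda>i. \<sigma> i t)) *
         (\<Prod>i = 1..k - 1. traj_prob k P0 T (\<sigma> i) (\<lambda>t. real_of_int (s t))))"
proof -
  let ?N = "flat_space k P0" and ?\<Sigma> = "{1..k - 1} \<rightarrow>\<^sub>E spin_trajs T"
  let ?S = "\<lambda>z. spin k u (\<lambda>v. z (Inl v)) (\<lambda>e. z (Inr e))"
  let ?A = "{z \<in> space ?N. \<forall>t\<le>Suc T. ?S z t [] = s t}"
  let ?B = "\<lambda>\<sigma>. {z \<in> space ?N. (\<forall>t\<le>Suc T. ?S z t [] = s t) \<and>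
    (\<forall>i\<in>{1..k - 1}. \<forall>t\<le>T. ?S z t [i] = \<sigma> i t)}"
  interpret N: prob_space ?N by (rule prob_space_flat_space)
  have meas: "(\<lambda>z. ?S z t []) \<in> ?N \<rightarrow>\<^sub>M count_space UNIV"
    "i \<in> {1..k - 1} \<Longrightarrow> (\<lambda>z. ?S z t [i]) \<in> ?N \<rightarrow>\<^sub>M count_space UNIV" for t i
    unfolding flat_space_def by (auto intro!: measurable_spin measurable_coord)
  have A: "?A \<in> sets ?N" using meas(1) by measurable
  have B: "?B \<sigma> \<in> sets ?N" for \<sigma>
  proof (rule sets.sets_Collect_conj)
    show "{z \<in> space ?N. \<forall>t\<le>Suc T. ?S z t [] = s t} \<in> sets ?N" by (rule A)
    show "{z \<in> space ?N. \<forall>i\<in>{1..k - 1}. \<forall>t\<le>T. ?S z t [i] = \<sigma> i t} \<in> sets ?N"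
    proof (rule sets.sets_Collect_finite_All')
      fix i assume "i \<in> {1..k - 1}"
      note [measurable] = meas(2)[OF this]
      show "{z \<in> space ?N. \<forall>t\<le>T. ?S z t [i] = \<sigma> i t} \<in> sets ?N" by measurable
    \<comment> \<open>By \<open>k \<ge> 2\<close> the index set \<open>{1..k - 1}\<close> is
      nonempty.\<close>
    qed (use assms(1) in auto)
  qed
  have fin: "finite ?\<Sigma>" by (intro finite_PiE) (auto simp: finite_spin_trajs)
  have disj: "disjoint_family_on ?B ?\<Sigma>"
    unfolding disjoint_family_on_def
  proof (intro ballI impI)
    fix \<sigma> \<sigma>' assume \<sigma>: "\<sigma> \<in> ?\<Sigma>" and \<sigma>': "\<sigma>' \<in> ?\<Sigma>" and "\<sigma> \<noteq> \<sigma>'"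
    then obtain i where i: "i \<in> {1..k - 1}" "\<sigma> i \<noteq> \<sigma>' i" by (metis PiE_ext)
    moreover from this \<sigma> \<sigma>' have "\<sigma> i \<in> spin_trajs T" "\<sigma>' i \<in> spin_trajs T" by auto
    ultimately obtain t where t: "t \<le> T" "\<sigma> i t \<noteq> \<sigma>' i t"
      unfolding spin_trajs_def by (metis PiE_ext atMost_iff)
    show "?B \<sigma> \<inter> ?B \<sigma>' = {}"
    proof (rule equals0I)
      fix z assume "z \<in> ?B \<sigma> \<inter> ?B \<sigma>'"
      then have "?S z t [i] = \<sigma> i t" "?S z t [i] = \<sigma>' i t" using i t by blast+
      with t show False by simp
    qed
  qed
  \<comment> \<open>Equality holds only up to a null set: initial spins or coins outside
    \<open>{-1, 1}\<close> could give a child a trajectory that the sum does not contain.\<close>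
  have "AE z in ?N. z \<in> ?A \<longleftrightarrow> z \<in> (\<Union>\<sigma>\<in>?\<Sigma>. ?B \<sigma>)"
    using AE_flat_space_pm1[OF assms(2), of k]
  proof eventually_elim
    case (elim z)
    \<comment> \<open>The trajectories actually followed by the children, restricted in both
      arguments so as to belong to the extensional function spaces.\<close>
    define \<sigma> where "\<sigma> = (\<lambda>i\<in>{1..k - 1}. \<lambda>t\<in>{..T}. ?S z t [i])"
    have "?S z t v \<in> {-1, 1}" if "v \<in> tree_verts k" for t v
      by (rule spin_pm1) (use elim that in auto)
    then have "\<sigma> \<in> ?\<Sigma>" by (auto simp: \<sigma>_def spin_trajs_def)
    moreover have "\<forall>i\<in>{1..k - 1}. \<forall>t\<le>T. ?S z t [i] = \<sigma> i t" by (simp add: \<sigma>_def)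
    ultimately show ?case by blast
  qed
  then have "measure ?N ?A = measure ?N (\<Union>\<sigma>\<in>?\<Sigma>. ?B \<sigma>)"
    by (rule N.finite_measure_eq_AE[OF _ A sets.finite_UN[OF fin B]])
  also have "\<dots> = (\<Sum>\<sigma>\<in>?\<Sigma>. measure ?N (?B \<sigma>))"
    by (rule N.finite_measure_finite_Union[OF fin image_subsetI[OF B] disj])
  also have "\<dots> = (\<Sum>\<sigma>\<in>?\<Sigma>. pmf P0 (s 0) * (\<Prod>t\<le>T. root_kernel k (u t) (s (Suc t)) (\<lambda>i. \<sigma> i t)) *
      (\<Prod>i=1..k - 1. traj_prob k P0 T (\<sigma> i) (\<lambda>t. real_of_int (s t))))"
  proof (rule sum.cong[OF refl])
    fix \<sigma> assume "\<sigma> \<in> ?\<Sigma>"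
    then have \<sigma>: "\<sigma> i \<in> spin_trajs T" if "i \<in> {1..k - 1}" for i using that by auto
    have s: "s (Suc t) \<in> {-1, 1}" if "t \<le> T" for t using assms(3)[of "Suc t"] that by simp
    show "measure ?N (?B \<sigma>) = pmf P0 (s 0) * (\<Prod>t\<le>T. root_kernel k (u t) (s (Suc t)) (\<lambda>i. \<sigma> i t)) *
      (\<Prod>i=1..k - 1. traj_prob k P0 T (\<sigma> i) (\<lambda>t. real_of_int (s t)))"
    proof -
      have iff: "(\<forall>t\<le>Suc T. ?S z t [] = s t) \<and> (\<forall>i\<in>{1..k - 1}. \<forall>t\<le>T. ?S z t [i] = \<sigma> i t) \<longleftrightarrow>
          z (Inl []) = s 0 \<and>
          (\<forall>t\<le>T. root_step k (u t) (s (Suc t)) (\<lambda>i. \<sigma> i t) (z (Inr ([], t)))) \<and>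
          (\<forall>i\<in>{1..k - 1}. \<forall>t\<le>T. spin k (\<lambda>t. real_of_int (s t)) (\<lambda>w. z (Inl (i # w)))
            (child_coins i (\<sigma> i) (\<lambda>e. z (Inr e))) t [] = \<sigma> i t)" for z
        by (rule root_trajectory_iff) (fact \<sigma>)
      show ?thesis
        unfolding iff by (rule measure_conditioned_root) (fact s, fact \<sigma>)
    qed
  qed
  finally show ?thesis
    unfolding traj_prob_flat[of k P0 "T + 1"] sum_distrib_left
    by (simp only: mult.assoc atLeast0AtMost Suc_eq_plus1)
qed

end
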